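(* Let $\alpha,\beta,\gamma$ be complex numbers and let $n\ge 0$ be an integer. Put $W_n=\sum_{j=0}^nS(n,j;\alpha,\beta,\gamma)$. Then $$W_n=\sum_{k=0}^n(-1)^n\left[\sum_{j=0}^nL(k,j;\alpha,\beta,\gamma)\right]S(n,k;\alpha,\beta,\gamma),$$ where $S(n,k;\alpha,\beta,\gamma)$ are the (Hsu--Shiue) unified generalized Stirling numbers and $L(k,j;\alpha,\beta,\gamma)$ are the generalized Lah-type numbers.
   Context: For a number $\theta$ let $(t|\theta)_n=\prod_{i=0}^{n-1}(t-i\theta)$, with $(t|\theta)_0=1$. The numbers $S(n,k;\alpha,\beta,\gamma)$, $0\le k\le n$, are defined by the polynomial identity in $t$ $$(t|\alpha)_n=\sum_{k=0}^nS(n,k;\alpha,\beta,\gamma)\,(t-\gamma|\beta)_k .$$ Write $S^1(n,k)=S(n,k;\alpha,\beta,\gamma)$ and $S^2(n,k)=S(n,k;\beta,\alpha,-\gamma)$, so that $(t|\beta)_n=\sum_{k=0}^nS^2(n,k)(t+\gamma|\alpha)_k$. The generalized Lah-type numbers are defined by $$L(n,j;\alpha,\beta,\gamma)=\sum_{k=j}^n(-1)^kS^2(n,k)S^1(k,j),$$ with $L(n,j;\alpha,\beta,\gamma)=0$ for $j>n$ (empty sum). *)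

theory Defs
  imports Complex_Main "HOL-Computational_Algebra.Polynomial"
begin

text \<open>The generalized factorial \<open>(t|\<theta>)\<^sub>n\<close>. It is stated over an arbitrary commutative ring so
  that \<open>t\<close> may be taken to be a polynomial.\<close>

definition gen_fact :: "'a::comm_ring_1 \<Rightarrow> 'a \<Rightarrow> nat \<Rightarrow> 'a" where
  "gen_fact t \<theta> n = (\<Prod>i<n. t - of_nat i * \<theta>)"

text \<open>The row \<open>c k = S(n,k;\<alpha>,\<beta>,\<gamma>)\<close> of connection coefficients: the indeterminate \<open>t\<close> is
  \<open>[:0, 1:]\<close>, so \<open>t - \<gamma>\<close> is \<open>[:- \<gamma>, 1:]\<close>. Entries beyond column \<open>n\<close> are set to zero.\<close>

definition is_stirling_row :: "complex \<Rightarrow> complex \<Rightarrow> complex \<Rightarrow> nat \<Rightarrow> (nat \<Rightarrow> complex) \<Rightarrow> bool" where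
  "is_stirling_row \<alpha> \<beta> \<gamma> n c \<longleftrightarrow> (\<forall>k>n. c k = 0) \<and>
     gen_fact [:0, 1:] [:\<alpha>:] n = (\<Sum>k=0..n. smult (c k) (gen_fact [:- \<gamma>, 1:] [:\<beta>:] k))"

definition gen_stirling :: "nat \<Rightarrow> nat \<Rightarrow> complex \<Rightarrow> complex \<Rightarrow> complex \<Rightarrow> complex" where
  "gen_stirling n k \<alpha> \<beta> \<gamma> = (THE c. is_stirling_row \<alpha> \<beta> \<gamma> n c) k"

definition gen_lah :: "nat \<Rightarrow> nat \<Rightarrow> complex \<Rightarrow> complex \<Rightarrow> complex \<Rightarrow> complex" where
  "gen_lah n j \<alpha> \<beta> \<gamma> =
     (\<Sum>k=j..n. (-1) ^ k * gen_stirling n k \<beta> \<alpha> (- \<gamma>) * gen_stirling k j \<alpha> \<beta> \<gamma>)"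

text \<open>The definite description in \<open>gen_stirling\<close> is well defined.\<close>

lemma gen_fact_linear_degree:
  fixes a \<theta> :: complex
  shows "degree (gen_fact [:a, 1:] [:\<theta>:] n) = n \<and> coeff (gen_fact [:a, 1:] [:\<theta>:] n) n = 1"
proof -
  have eq: "gen_fact [:a, 1:] [:\<theta>:] n = (\<Prod>i<n. [:a - of_nat i * \<theta>, 1:])"
    unfolding gen_fact_def by (rule prod.cong) (auto simp: of_nat_poly)
  have deg: "degree (\<Prod>i<n. [:a - of_nat i * \<theta>, 1:]) = n"
    by (subst degree_prod_eq_sum_degree) auto
  moreover have "lead_coeff (\<Prod>i<n. [:a - of_nat i * \<theta>, 1:]) = 1"
    by (simp add: lead_coeff_prod)
  ultimately show ?thesis unfolding eq by simp
qed

lemma poly_basis_unique: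
  fixes p :: "complex poly" and b :: "nat \<Rightarrow> complex poly"
  assumes b: "\<And>k. degree (b k) = k \<and> coeff (b k) k = 1"
  assumes "degree p \<le> n"
  shows "\<exists>!c. (\<forall>k>n. c k = 0) \<and> p = (\<Sum>k=0..n. smult (c k) (b k))"
  using assms(2)
proof (induction n arbitrary: p)
  case 0
  have b0: "b 0 = 1" using b[of 0] degree_0_id[of "b 0"] by (simp add: one_pCons)
  obtain a where a: "p = [:a:]" using 0 by (auto elim: degree_eq_zeroE)
  show ?case
  proof (rule ex1I[of _ "\<lambda>k::nat. if k = 0 then a else 0"])
    show "(\<forall>k>(0::nat). (if k = 0 then a else 0) = 0) \<and>
      p = (\<Sum>k=0..(0::nat). smult (if k = 0 then a else 0) (b k))"
      by (simp add: a b0)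
  next
    fix c assume "(\<forall>k>0. c k = 0) \<and> p = (\<Sum>k=0..0. smult (c k) (b k))"
    then show "c = (\<lambda>k. if k = 0 then a else 0)" by (auto simp: a b0 fun_eq_iff)
  qed
next
  case (Suc n)
  define q where "q = p - smult (coeff p (Suc n)) (b (Suc n))"
  have degq: "degree q \<le> n"
  proof (rule degree_le, intro allI impI)
    fix i assume "n < i"
    then consider "i = Suc n" | "i > Suc n" by linarith
    then show "coeff q i = 0"
      using b[of "Suc n"] Suc.prems by cases (auto simp: q_def coeff_eq_0)
  qed
  from Suc.IH[OF this] obtain c where c: "\<forall>k>n. c k = 0" "q = (\<Sum>k=0..n. smult (c k) (b k))"
    and u: "\<And>d. \<forall>k>n. d k = 0 \<Longrightarrow> q = (\<Sum>k=0..n. smult (d k) (b k)) \<Longrightarrow> d = c" by blast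
  show ?case
  proof (rule ex1I[of _ "c(Suc n := coeff p (Suc n))"])
    have "(\<Sum>k=0..n. smult ((c(Suc n := coeff p (Suc n))) k) (b k)) = q"
      unfolding c(2) by (rule sum.cong) auto
    then show "(\<forall>k>Suc n. (c(Suc n := coeff p (Suc n))) k = 0) \<and>
      p = (\<Sum>k=0..Suc n. smult ((c(Suc n := coeff p (Suc n))) k) (b k))"
      using c(1) by (simp add: q_def)
  next
    fix d assume d: "(\<forall>k>Suc n. d k = 0) \<and> p = (\<Sum>k=0..Suc n. smult (d k) (b k))"
    have "coeff (\<Sum>k=0..n. smult (d k) (b k)) (Suc n) = 0"
      using b by (auto simp: coeff_sum intro!: sum.neutral coeff_eq_0)
    then have top: "coeff p (Suc n) = d (Suc n)"
      using d b[of "Suc n"] by simp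
    have "q = (\<Sum>k=0..n. smult (d k) (b k))" using d unfolding q_def top by simp
    also have "\<dots> = (\<Sum>k=0..n. smult ((d(Suc n := 0)) k) (b k))" by (rule sum.cong) auto
    finally have "d(Suc n := 0) = c" using d by (intro u) auto
    then show "d = c(Suc n := coeff p (Suc n))" by (auto simp: top)
  qed
qed

lemma ex1_stirling_row: "\<exists>!c. is_stirling_row \<alpha> \<beta> \<gamma> n c"
  unfolding is_stirling_row_def
  using gen_fact_linear_degree by (intro poly_basis_unique) auto

lemma gen_stirling_row: "is_stirling_row \<alpha> \<beta> \<gamma> n (\<lambda>k. gen_stirling n k \<alpha> \<beta> \<gamma>)"
  using theI'[OF ex1_stirling_row] by (simp add: gen_stirling_def)

end

theory Submission
  imports Defs
begin

text \<open>Substituting \<open>t - \<gamma>\<close> for \<open>t\<close> in the row identity of \<open>S\<^sup>2\<close> and inserting it into that of \<open>S\<^sup>1\<close>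
  shows that the lower triangular matrices \<open>S\<^sup>1\<close> and \<open>S\<^sup>2\<close> are mutually inverse. With
  \<open>D = diag((-1)\<^sup>k)\<close> one has \<open>L = S\<^sup>2 D S\<^sup>1\<close>, hence \<open>S\<^sup>1 L = D S\<^sup>1\<close>; the theorem compares the
  row sums of both sides.\<close>

lemma gen_stirling_eq_0: "n < k \<Longrightarrow> gen_stirling n k \<alpha> \<beta> \<gamma> = 0"
  using gen_stirling_row[of \<alpha> \<beta> \<gamma> n] by (simp add: is_stirling_row_def)

text \<open>Translating the variable shifts every linear factor by the same constant and leaves the
  increments \<open>\<theta>\<close> alone.\<close>

lemma pcompose_gen_fact_linear:
  fixes a c \<theta> :: complex
  shows "pcompose (gen_fact [:a, 1:] [:\<theta>:] n) [:c, 1:] = gen_fact [:a + c, 1:] [:\<theta>:] n"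
  by (auto simp: gen_fact_def pcompose_prod of_nat_poly pcompose_pCons intro!: prod.cong)

lemma smult_sum_right: "smult a (\<Sum>i\<in>A. f i) = (\<Sum>i\<in>A. smult a (f i))"
  by (induction A rule: infinite_finite_induct) (simp_all add: smult_add_right)

lemma gen_fact_shift_expansion:
  "gen_fact [:- \<gamma>, 1:] [:\<beta>:] k =
    (\<Sum>m=0..k. smult (gen_stirling k m \<beta> \<alpha> (- \<gamma>)) (gen_fact [:0, 1:] [:\<alpha>:] m))"
proof -
  have "gen_fact [:0, 1:] [:\<beta>:] k =
      (\<Sum>m=0..k. smult (gen_stirling k m \<beta> \<alpha> (- \<gamma>)) (gen_fact [:\<gamma>, 1:] [:\<alpha>:] m))"
    using gen_stirling_row[of \<beta> \<alpha> "- \<gamma>" k] by (simp add: is_stirling_row_def)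
  \<comment> \<open>The shift by \<open>- \<gamma>\<close> moves offset \<open>0\<close> to
    \<open>- \<gamma>\<close> on the left and offset \<open>\<gamma>\<close> to \<open>0\<close> on
    the right.\<close>
  from arg_cong[OF this, of "\<lambda>p. pcompose p [:- \<gamma>, 1:]"] show ?thesis
    by (simp add: pcompose_sum pcompose_smult pcompose_gen_fact_linear)
qed

text \<open>As functions of \<open>m\<close>, both sides are coordinates of
  \<open>(t|\<alpha>)_n\<close> in the monic basis \<open>(t|\<alpha>)_m\<close>, so uniqueness of
  coordinates identifies them.\<close>

lemma gen_stirling_orthogonal:
  "(\<Sum>k=0..n. gen_stirling n k \<alpha> \<beta> \<gamma> * gen_stirling k m \<beta> \<alpha> (- \<gamma>)) = (if m = n then 1 else 0)"
proof -
  let ?b = "\<lambda>m. gen_fact [:0, 1:] [:\<alpha>:] m"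
  let ?P = "\<lambda>c. (\<forall>k>n. c k = 0) \<and> ?b n = (\<Sum>k=0..n. smult (c k) (?b k))"
  let ?c = "\<lambda>m. \<Sum>k=0..n. gen_stirling n k \<alpha> \<beta> \<gamma> * gen_stirling k m \<beta> \<alpha> (- \<gamma>)"
  let ?d = "\<lambda>m. if m = n then 1 else 0 :: complex"
  have "?b n = (\<Sum>k=0..n. smult (gen_stirling n k \<alpha> \<beta> \<gamma>) (gen_fact [:- \<gamma>, 1:] [:\<beta>:] k))"
    using gen_stirling_row[of \<alpha> \<beta> \<gamma> n] by (simp add: is_stirling_row_def)
  also have "\<dots> = (\<Sum>k=0..n. \<Sum>m=0..n.
      smult (gen_stirling n k \<alpha> \<beta> \<gamma> * gen_stirling k m \<beta> \<alpha> (- \<gamma>)) (?b m))"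
  proof (rule sum.cong[OF refl])
    fix k assume "k \<in> {0..n}"
    \<comment> \<open>Zero entries pad the range from \<open>k\<close> to \<open>n\<close>, which
      makes the double sum rectangular and ready for swapping.\<close>
    then have "gen_fact [:- \<gamma>, 1:] [:\<beta>:] k =
        (\<Sum>m=0..n. smult (gen_stirling k m \<beta> \<alpha> (- \<gamma>)) (?b m))"
      unfolding gen_fact_shift_expansion[of \<gamma> \<beta> k \<alpha>]
      by (intro sum.mono_neutral_left) (auto simp: gen_stirling_eq_0)
    then show "smult (gen_stirling n k \<alpha> \<beta> \<gamma>) (gen_fact [:- \<gamma>, 1:] [:\<beta>:] k) =
        (\<Sum>m=0..n. smult (gen_stirling n k \<alpha> \<beta> \<gamma> * gen_stirling k m \<beta> \<alpha> (- \<gamma>)) (?b m))"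
      by (simp add: smult_sum_right)
  qed
  also have "\<dots> = (\<Sum>m=0..n. smult (?c m) (?b m))"
    by (subst sum.swap) (simp add: smult_sum)
  finally have "?b n = (\<Sum>m=0..n. smult (?c m) (?b m))" .
  moreover have "\<forall>m>n. ?c m = 0"
    by (auto simp: gen_stirling_eq_0 intro!: sum.neutral)
  ultimately have c: "?P ?c" by (intro conjI)
  \<comment> \<open>The competing expansion is the trivial one, \<open>?b n\<close> as a basis
    vector.\<close>
  have "(\<Sum>k=0..n. smult (?d k) (?b k)) = (\<Sum>k=0..n. if k = n then ?b k else 0)"
    by (rule sum.cong) auto
  then have d: "?P ?d"
    by simp
  have ex1: "\<exists>!c. ?P c"
    using gen_fact_linear_degree by (intro poly_basis_unique) auto
  have "?c = ?d"
    using the1_equality[of ?P, OF ex1 c] the1_equality[of ?P, OF ex1 d] by (rule trans[OF sym])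
  then show ?thesis by (rule fun_cong)
qed

text \<open>Triangularity of \<open>S1\<close> kills the terms with \<open>i < j\<close>, that of
  \<open>S2\<close> those with \<open>i > k\<close>. The new range depends on neither
  \<open>j\<close> nor \<open>k\<close>, so sums can be interchanged.\<close>

lemma gen_lah_extend_sum:
  assumes "k \<le> n"
  shows "gen_lah k j \<alpha> \<beta> \<gamma> =
    (\<Sum>i=0..n. (-1) ^ i * gen_stirling k i \<beta> \<alpha> (- \<gamma>) * gen_stirling i j \<alpha> \<beta> \<gamma>)"
  unfolding gen_lah_def using assms
  by (intro sum.mono_neutral_left) (auto simp: gen_stirling_eq_0 not_le)

lemma sum_gen_stirling_gen_lah:
  "(\<Sum>k=0..n. gen_stirling n k \<alpha> \<beta> \<gamma> * gen_lah k j \<alpha> \<beta> \<gamma>) = (-1) ^ n * gen_stirling n j \<alpha> \<beta> \<gamma>"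
proof -
  have "(\<Sum>k=0..n. gen_stirling n k \<alpha> \<beta> \<gamma> * gen_lah k j \<alpha> \<beta> \<gamma>) =
      (\<Sum>k=0..n. \<Sum>i=0..n. gen_stirling n k \<alpha> \<beta> \<gamma> *
        ((-1) ^ i * gen_stirling k i \<beta> \<alpha> (- \<gamma>) * gen_stirling i j \<alpha> \<beta> \<gamma>))"
    by (intro sum.cong refl) (simp add: gen_lah_extend_sum sum_distrib_left)
  also have "\<dots> = (\<Sum>i=0..n. (\<Sum>k=0..n. gen_stirling n k \<alpha> \<beta> \<gamma> * gen_stirling k i \<beta> \<alpha> (- \<gamma>)) *
      ((-1) ^ i * gen_stirling i j \<alpha> \<beta> \<gamma>))"
    by (subst sum.swap) (simp add: sum_distrib_left sum_distrib_right mult_ac)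
  \<comment> \<open>Orthogonality turns the inner sum into a Kronecker delta, leaving only the sign
    at \<open>i = n\<close>.\<close>
  also have "\<dots> = (\<Sum>i=0..n. if i = n then (-1) ^ i * gen_stirling i j \<alpha> \<beta> \<gamma> else 0)"
    by (intro sum.cong refl) (simp add: gen_stirling_orthogonal)
  finally show ?thesis by simp
qed

theorem mainTheorem5:
  fixes \<alpha> \<beta> \<gamma> :: complex and n :: nat
  shows "(\<Sum>j=0..n. gen_stirling n j \<alpha> \<beta> \<gamma>) =
    (\<Sum>k=0..n. (-1) ^ n * (\<Sum>j=0..n. gen_lah k j \<alpha> \<beta> \<gamma>) * gen_stirling n k \<alpha> \<beta> \<gamma>)"
proof -
  have "(\<Sum>k=0..n. (-1) ^ n * (\<Sum>j=0..n. gen_lah k j \<alpha> \<beta> \<gamma>) * gen_stirling n k \<alpha> \<beta> \<gamma>) =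
      (\<Sum>j=0..n. (-1) ^ n * (\<Sum>k=0..n. gen_stirling n k \<alpha> \<beta> \<gamma> * gen_lah k j \<alpha> \<beta> \<gamma>))"
    unfolding sum_distrib_left sum_distrib_right
    by (subst sum.swap) (simp add: mult_ac)
  \<comment> \<open>The prefactor \<open>(-1) ^ n\<close> cancels the sign produced by the inner
    sum.\<close>
  also have "\<dots> = (\<Sum>j=0..n. gen_stirling n j \<alpha> \<beta> \<gamma>)"
    by (simp add: sum_gen_stirling_gen_lah flip: mult.assoc power_mult_distrib)
  finally show ?thesis by simp
qed

end
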